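(* Let $K$ be the Strichartz hexacarpet and, for $\mu\in(0,1)$, let $d_\mu$ be the pseudo-metric on $K$ defined by the weight function $g_\mu(w)=\mu^{|w|}$. Then $d_\mu$ is a metric if and only if $\mu\in[1/2,1)$. Moreover, for all $\mu\in[1/2,1)$ the following hold. For all $i\in W$ and all $x,y\in K$, $$d_\mu(f_i(x),f_i(y))=\mu\, d_\mu(x,y).$$ For all $w\in W_*$, $$\mathrm{diam}_\mu(K_w):=\sup\{d_\mu(x,y):x,y\in K_w\}=\mu^{|w|}.$$ The Hausdorff dimension of $(K,d_\mu)$ is $\alpha=-\log 6/\log\mu$, and the normalized Hausdorff measure $\nu$ of dimension $\alpha$ exists.
   Context: Let $W=\{0,1,2,3,4,5\}$, $W_0=\{\emptyset\}$, $W_n=W^n$ the set of words $w=w_1\ldots w_n$ of length $n$ ($n\ge1$), $W_*=\bigcup_{n\ge0}W_n$, and $|w|=n$ for $w\in W_n$ (with $|\emptyset|=0$). Let $W_\infty$ be the set of infinite words $w_1w_2\ldots$ over $W$ with the product topology (equivalently, the topology of the ultrametric $r^{s(\cdot,\cdot)}$, $r\in(0,1)$, where $s$ is the first index at which two words differ). Concatenation is written by juxtaposition; $\{0,5\}^\infty\subseteq W_\infty$ is the set of infinite words with all letters in $\{0,5\}$. Let $\sim$ be the equivalence relation on $W_\infty$ whose only non-trivial identifications are the following: for all $w\in W_*$, $i\in W$, $j=i+1\ (\mathrm{mod}\ 6)$, $v\in\{0,5\}^\infty$: if $i$ is even, $wi1v\sim wj1v$ and $wi2v\sim wj2v$; if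 $i$ is odd, $wi3v\sim wj3v$ and $wi4v\sim wj4v$. The Strichartz hexacarpet is $K=W_\infty/\!\sim$ with the quotient topology, $\pi:W_\infty\to K$ the quotient map. For $i\in W$, $f_i:K\to K$ is the unique map with $\pi(iw)=f_i(\pi(w))$ for all $w\in W_\infty$. For $w=w_1\ldots w_n\in W_*$, $f_w=f_{w_1}\circ\cdots\circ f_{w_n}$ ($f_\emptyset=\mathrm{id}$) and $K_w=f_w(K)$. For $\mu\in(0,1)$ and $w\in W_*$ let $g_\mu(w)=\mu^{|w|}$. A chain is a finite sequence $\{w^{(1)},\ldots,w^{(m)}\}$ ($m\ge1$) of elements of $W_*$ with $K_{w^{(i)}}\cap K_{w^{(i+1)}}\ne\emptyset$ for $i=1,\ldots,m-1$. For $x,y\in K$, $\mathcal{C}(x,y)$ is the set of chains with $x\in K_{w^{(1)}}$ and $y\in K_{w^{(m)}}$, and $$d_\mu(x,y)=\inf\Big\{\sum_{i=1}^m g_\mu(w^{(i)}):\{w^{(1)},\ldots,w^{(m)}\}\in\mathcal{C}(x,y)\Big\},$$ which is a pseudo-metric on $K$. That the normalized Hausdorff measure of dimension $\alpha$ exists means that the $\alpha$-dimensional Hausdorff measure $\mathcal{H}^\alpha$ of $(K,d_\mu)$ satisfies $0<\mathcal{H}^\alpha(K)<\infty$, and then $\nu=\mathcal{H}^\alpha/\mathcal{H}^\alpha(K)$. *)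

theory Defs
  imports "HOL-Analysis.Analysis" "HOL-Library.Stream" "HOL-Library.Numeral_Type"
begin

section \<open>The Strichartz hexacarpet\<close>

text \<open>
  The alphabet $W$ is the six-element numeral type \<open>6\<close>, whose addition is addition modulo 6.
  Finite words are lists and infinite words are streams over this type.
\<close>

type_synonym letter = 6

inductive hex_ident :: "letter stream \<Rightarrow> letter stream \<Rightarrow> bool" where
  even: "i \<in> {0, 2, 4} \<Longrightarrow> k \<in> {1, 2} \<Longrightarrow> sset v \<subseteq> {0, 5} \<Longrightarrow>
    hex_ident (w @- i ## k ## v) (w @- (i + 1) ## k ## v)"
| odd: "i \<in> {1, 3, 5} \<Longrightarrow> k \<in> {3, 4} \<Longrightarrow> sset v \<subseteq> {0, 5} \<Longrightarrow>
    hex_ident (w @- i ## k ## v) (w @- (i + 1) ## k ## v)"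

abbreviation hex_equiv :: "letter stream \<Rightarrow> letter stream \<Rightarrow> bool" where
  "hex_equiv \<equiv> equivclp hex_ident"

lemma equivp_hex_equiv: "equivp hex_equiv"
  by (rule equivp_evquivclp)

quotient_type hexacarpet = "letter stream" / hex_equiv
  by (rule equivp_hex_equiv)

lemma hex_ident_SCons: "hex_ident u v \<Longrightarrow> hex_ident (i ## u) (i ## v)"
proof (induction rule: hex_ident.induct)
  case (even j k v w)
  then show ?case using hex_ident.even[of j k v "i # w"] by simp
next
  case (odd j k v w)
  then show ?case using hex_ident.odd[of j k v "i # w"] by simp
qed

lemma hex_equiv_SCons: "hex_equiv u v \<Longrightarrow> hex_equiv (i ## u) (i ## v)"
proof (induction rule: equivclp_induct)
  case base
  show ?case by simp
next
  case (step y z)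
  then have "hex_equiv (i ## y) (i ## z)"
    by (meson hex_ident_SCons r_into_equivclp converse_r_into_equivclp)
  with step show ?case by (meson equivclp_trans)
qed

lift_definition hex_map :: "letter \<Rightarrow> hexacarpet \<Rightarrow> hexacarpet" is "(##)"
  by (rule hex_equiv_SCons)

definition hex_map_word :: "letter list \<Rightarrow> hexacarpet \<Rightarrow> hexacarpet" where
  "hex_map_word w = foldr hex_map w"

definition hex_cell :: "letter list \<Rightarrow> hexacarpet set" where
  "hex_cell w = range (hex_map_word w)"

section \<open>The pseudo-metrics\<close>

definition hex_weight :: "real \<Rightarrow> letter list \<Rightarrow> real" where
  "hex_weight \<mu> w = \<mu> ^ length w"

definition hex_chains :: "hexacarpet \<Rightarrow> hexacarpet \<Rightarrow> letter list list set" where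
  "hex_chains x y = {ws. ws \<noteq> [] \<and>
     successively (\<lambda>v w. hex_cell v \<inter> hex_cell w \<noteq> {}) ws \<and>
     x \<in> hex_cell (hd ws) \<and> y \<in> hex_cell (last ws)}"

text \<open>
  For \<open>\<mu> > 0\<close> the infimum is over a non-empty set bounded below by 0: \<open>[[]]\<close> is a chain between
  any two points.
\<close>

definition hex_dist :: "real \<Rightarrow> hexacarpet \<Rightarrow> hexacarpet \<Rightarrow> real" where
  "hex_dist \<mu> x y = (INF ws \<in> hex_chains x y. \<Sum>w\<leftarrow>ws. hex_weight \<mu> w)"

section \<open>Hausdorff measure and dimension\<close>

definition set_ediam :: "('a \<Rightarrow> 'a \<Rightarrow> real) \<Rightarrow> 'a set \<Rightarrow> ennreal" where
  "set_ediam d A = (SUP x\<in>A. SUP y\<in>A. ennreal (d x y))"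

text \<open>
  The \<open>s\<close>-th power of the diameter, used below only for sets of finite diameter and \<open>s \<ge> 0\<close>.
  For \<open>s = 0\<close> a non-empty set has weight 1, even if its diameter is 0 (recall that
  \<open>0 powr 0 = 0\<close>), so that the 0-dimensional Hausdorff measure is counting measure.
\<close>

definition ediam_powr :: "('a \<Rightarrow> 'a \<Rightarrow> real) \<Rightarrow> real \<Rightarrow> 'a set \<Rightarrow> ennreal" where
  "ediam_powr d s A =
     (if A = {} then 0 else if s = 0 then 1 else ennreal (enn2real (set_ediam d A) powr s))"

text \<open>Countable covers are sequences of sets; finite covers are padded with the empty set.\<close>

definition hausdorff_premeasure ::
  "('a \<Rightarrow> 'a \<Rightarrow> real) \<Rightarrow> real \<Rightarrow> real \<Rightarrow> 'a set \<Rightarrow> ennreal" where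
  "hausdorff_premeasure d s \<delta> A =
     (INF U \<in> {U :: nat \<Rightarrow> 'a set. A \<subseteq> (\<Union>n. U n) \<and> (\<forall>n. set_ediam d (U n) \<le> ennreal \<delta>)}.
        \<Sum>n. ediam_powr d s (U n))"

definition hausdorff_measure :: "('a \<Rightarrow> 'a \<Rightarrow> real) \<Rightarrow> real \<Rightarrow> 'a set \<Rightarrow> ennreal" where
  "hausdorff_measure d s A = (SUP \<delta>\<in>{0<..}. hausdorff_premeasure d s \<delta> A)"

definition hausdorff_dim :: "('a \<Rightarrow> 'a \<Rightarrow> real) \<Rightarrow> 'a set \<Rightarrow> ennreal" where
  "hausdorff_dim d A = (INF s \<in> {s. 0 \<le> s \<and> hausdorff_measure d s A = 0}. ennreal s)"

text \<open>
  Existence of the normalized Hausdorff measure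
  \<open>\<lambda>A. hausdorff_measure d s A / hausdorff_measure d s UNIV\<close>.
\<close>

definition normalized_hausdorff_measure_exists :: "('a \<Rightarrow> 'a \<Rightarrow> real) \<Rightarrow> real \<Rightarrow> bool" where
  "normalized_hausdorff_measure_exists d s \<longleftrightarrow>
     0 < hausdorff_measure d s UNIV \<and> hausdorff_measure d s UNIV < \<infinity>"

end

theory Submission
  imports Defs "HOL-Probability.Stream_Space" "HOL-Probability.Probability_Mass_Function"
begin

text \<open>Write \<open>f\<^sub>i\<close> for \<open>hex_map i\<close>. Everything rests on one function and one map. Reading the letters
  \<open>0, 5\<close> as the increasing and the other four letters as the decreasing branch of the tent map
  turns a word into a number \<open>tent\<close> in \<open>[0, 1]\<close>. It respects all identifications: two glued words
  are \<open>i k v\<close> and \<open>j k v\<close> behind a common prefix, where \<open>k \<notin> {0, 5}\<close> and \<open>v \<in> {0, 5}\<^sup>\<infinity>\<close>, and the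
  number of \<open>i k v\<close> is \<open>1 / 2\<close> whatever \<open>i\<close> is. The oscillation of \<open>tent\<close> on a cell of level \<open>n\<close> is
  at most \<open>2\<^sup>-\<^sup>n\<close>, hence at most \<open>\<mu>\<^sup>n\<close> if \<open>\<mu> \<ge> 1 / 2\<close>, and summing along chains makes it
  1-Lipschitz (\<open>osc_bounded_lipschitz\<close>). Deleting the first letter also respects the
  identifications; as chains can be shifted, this map expands distances by at most \<open>1 / \<mu>\<close>
  (\<open>hex_dist_shift\<close>), which together with the obvious opposite bound is the self-similarity
  \<open>hex_dist_map\<close>, valid for every \<open>\<mu>\<close>.

  For \<open>\<mu> < 1 / 2\<close> the points \<open>a\<close> and \<open>b\<close> of the words \<open>000\<dots>\<close> and \<open>1000\<dots>\<close> are distinct, but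
  \<open>f\<^sub>0 a = a\<close>, \<open>f\<^sub>1 a = b\<close> and \<open>f\<^sub>0 b = f\<^sub>1 b\<close> give \<open>d a b \<le> 2 * \<mu> * d a b\<close>, so \<open>d a b = 0\<close>
  (\<open>not_metric_below_half\<close>). For \<open>\<mu> \<ge> 1 / 2\<close> the same two points have distance 1 because their
  values of \<open>tent\<close> are 0 and 1; by self-similarity this gives the diameters of all cells.

  The fine structure for \<open>\<mu> \<ge> 1 / 2\<close> comes from two bump functions built from \<open>tent\<close>. They show
  that a word at distance less than \<open>\<mu>\<^sup>n / 4\<close> from a point on the common side of two neighbouring
  first-level cells shares its first \<open>n\<close> letters with one of the two representatives of that
  point (\<open>near_edge\<close>). A short chain between different first-level cells passes through such a
  point (\<open>crossing\<close>). So distance 0 forces equality, and by induction a set of diameter less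
  than \<open>\<mu>\<^sup>n / 8\<close> meets at most two cylinders of level \<open>n\<close> (\<open>two_cylinders\<close>), which have total
  mass at most \<open>2 * 6\<^sup>-\<^sup>n\<close> under the uniform distribution of words. As \<open>\<mu>\<^sup>\<alpha> = 1 / 6\<close> for
  \<open>\<alpha> = - ln 6 / ln \<mu>\<close>, the mass distribution principle bounds the \<open>\<alpha>\<close>-dimensional Hausdorff measure
  from below; the covers by all cells of a fixed level bound it from above.\<close>

section \<open>The identification of words\<close>

lemma letter_cases: "(i :: letter) = 0 \<or> i = 1 \<or> i = 2 \<or> i = 3 \<or> i = 4 \<or> i = 5"
proof -
  have "{0, 1, 2, 3, 4, 5} = (UNIV :: letter set)"
    by (rule card_subset_eq) auto
  then show ?thesis by blast
qed

text \<open>For \<open>k \<notin> {0, 5}\<close>, \<open>nbr k i\<close> is the cell that is glued to cell \<open>i\<close> along the side through its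
  subcell \<open>k\<close>: the cells form a hexagon, and \<open>k \<in> {1, 2}\<close> or \<open>k \<in> {3, 4}\<close> selects one of the two
  neighbours. In contrast to the ordered generating pairs \<open>(i, i + 1)\<close>, it is an involution.\<close>

definition nbr :: "letter \<Rightarrow> letter \<Rightarrow> letter" where
  "nbr k i = (if (i \<in> {0, 2, 4}) = (k \<in> {1, 2}) then i + 1 else i - 1)"

lemma nbr_nbr [simp]: "nbr k (nbr k i) = i"
  using letter_cases[of i] by (auto simp: nbr_def)

text \<open>The symmetric form of the identifications, arranged so that the common prefix is peeled off
  letter by letter.\<close>

inductive hex_edge :: "letter stream \<Rightarrow> letter stream \<Rightarrow> bool" where
  base: "k \<notin> {0, 5} \<Longrightarrow> sset v \<subseteq> {0, 5} \<Longrightarrow> hex_edge (i ## k ## v) (nbr k i ## k ## v)"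
| step: "hex_edge s t \<Longrightarrow> hex_edge (l ## s) (l ## t)"

lemma hex_edge_shift: "hex_edge s t \<Longrightarrow> hex_edge (w @- s) (w @- t)"
  by (induction w) (auto intro: hex_edge.step)

lemma hex_edge_sym: "hex_edge s t \<Longrightarrow> hex_edge t s"
proof (induction rule: hex_edge.induct)
  case (base k v i)
  then show ?case using hex_edge.base[of k v "nbr k i"] by simp
qed (rule hex_edge.step)

text \<open>The letter \<open>k \<notin> {0, 5}\<close> of an identified word is preceded by at least the letter \<open>i\<close>. This keeps
  the two rules for \<open>hex_edge\<close> apart and so makes the partner of a word unique.\<close>

lemma hex_edge_not_outer: "hex_edge s t \<Longrightarrow> \<not> sset (stl s) \<subseteq> {0, 5}"
proof (induction rule: hex_edge.induct)
  case (step s t l)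
  then show ?case by (metis stl_sset stream.sel(2) subset_iff)
qed auto

lemma hex_edge_unique: "hex_edge s t \<Longrightarrow> hex_edge s t' \<Longrightarrow> t = t'"
proof (induction arbitrary: t' rule: hex_edge.induct)
  case (base k v i)
  have "\<not> hex_edge (k ## v) u" for u
    using hex_edge_not_outer[of "k ## v" u] base(2) by auto
  with base(3) show ?case
    by (auto elim: hex_edge.cases)
next
  case (step s t l)
  have "\<not> sset (stl s) \<subseteq> {0, 5}"
    using step(1) by (rule hex_edge_not_outer)
  with step(3) have "\<exists>u. t' = l ## u \<and> hex_edge s u"
    by (cases rule: hex_edge.cases) auto
  with step(2) show ?case by auto
qed

lemma hex_ident_imp_edge: "hex_ident s t \<Longrightarrow> hex_edge s t"
proof (induction rule: hex_ident.induct)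
  case (even i k v w)
  then have "hex_edge (i ## k ## v) (nbr k i ## k ## v)"
    by (intro hex_edge.base) auto
  moreover have "nbr k i = i + 1" using even by (auto simp: nbr_def)
  ultimately show ?case by (simp add: hex_edge_shift)
next
  case (odd i k v w)
  then have "hex_edge (i ## k ## v) (nbr k i ## k ## v)"
    by (intro hex_edge.base) auto
  moreover have "nbr k i = i + 1" using odd by (auto simp: nbr_def)
  ultimately show ?case by (simp add: hex_edge_shift)
qed

lemma hex_edge_imp_ident: "hex_edge s t \<Longrightarrow> hex_ident s t \<or> hex_ident t s"
proof (induction rule: hex_edge.induct)
  case (base k v i)
  have *: "hex_ident (j ## k ## v) ((j + 1) ## k ## v)" if "nbr k j = j + 1" for j
  proof -
    have "(j \<in> {0, 2, 4}) = (k \<in> {1, 2})"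
      using that letter_cases[of j] by (auto simp: nbr_def split: if_splits)
    moreover have "k \<in> {1, 2} \<or> k \<in> {3, 4}"
      using base(1) letter_cases[of k] by auto
    moreover have "j \<in> {0, 2, 4} \<or> j \<in> {1, 3, 5}"
      using letter_cases[of j] by auto
    ultimately show ?thesis
      using hex_ident.even[of j k v "[]"] hex_ident.odd[of j k v "[]"] base(2) by auto
  qed
  show ?case
  proof (cases "nbr k i = i + 1")
    case False
    then have "nbr k i = i - 1" by (metis nbr_def)
    then have "hex_ident (nbr k i ## k ## v) (i ## k ## v)"
      using *[of "nbr k i"] by (metis diff_add_cancel nbr_nbr)
    then show ?thesis by simp
  qed (use *[of i] in simp)
qed (auto intro: hex_ident_SCons)

text \<open>Since partners are unique, taking the transitive closure adds nothing: every point has at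
  most two representatives.\<close>

lemma hex_equiv_iff: "hex_equiv s t \<longleftrightarrow> s = t \<or> hex_edge s t"
proof
  show "hex_equiv s t \<Longrightarrow> s = t \<or> hex_edge s t"
  proof (induction rule: equivclp_induct)
    case (step y z)
    have "hex_edge y z"
      using step(2) hex_ident_imp_edge hex_edge_sym by blast
    then show ?case using step(3) hex_edge_unique hex_edge_sym by blast
  qed simp
  show "s = t \<or> hex_edge s t \<Longrightarrow> hex_equiv s t"
    by (metis equivclp_refl hex_edge_imp_ident r_into_equivclp converse_r_into_equivclp)
qed

abbreviation \<pi> :: "letter stream \<Rightarrow> hexacarpet" where "\<pi> \<equiv> abs_hexacarpet"

lemma hexacarpet_eq_iff: "\<pi> s = \<pi> t \<longleftrightarrow> s = t \<or> hex_edge s t"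
  by (simp add: hexacarpet.abs_eq_iff hex_equiv_iff)

lemma hexacarpet_cases: obtains s where "x = \<pi> s"
  by (metis Quotient3_abs_rep Quotient3_hexacarpet)

lemma edge_point_eq: "k \<notin> {0, 5} \<Longrightarrow> sset v \<subseteq> {0, 5} \<Longrightarrow>
  \<pi> (i ## k ## v) = \<pi> (nbr k i ## k ## v)"
  by (simp add: hexacarpet_eq_iff hex_edge.base)

section \<open>Cells and the shift map\<close>

lemma hex_map_word_abs: "hex_map_word w (\<pi> s) = \<pi> (w @- s)"
  by (induction w) (auto simp: hex_map_word_def hex_map.abs_eq)

lemma hex_cell_eq: "hex_cell w = range (\<lambda>s. \<pi> (w @- s))"
proof -
  have "hex_cell w = hex_map_word w ` range \<pi>"
    unfolding hex_cell_def by (metis hexacarpet_cases surj_def)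
  then show ?thesis by (simp add: image_image hex_map_word_abs)
qed

lemma hex_cell_Cons: "hex_cell (i # w) = hex_map i ` hex_cell w"
  by (simp add: hex_cell_eq image_image hex_map.abs_eq)

lemma hex_cell_Nil [simp]: "x \<in> hex_cell []"
  by (auto simp: hex_cell_def hex_map_word_def)

lemma in_cell_ex: "\<exists>w. length w = n \<and> x \<in> hex_cell w"
proof -
  obtain s where s: "x = \<pi> s" by (rule hexacarpet_cases)
  have "x \<in> hex_cell (stake n s)"
    unfolding s hex_cell_eq by (rule range_eqI[of _ _ "sdrop n s"]) (simp add: stake_sdrop)
  then show ?thesis by (intro exI[of _ "stake n s"]) simp
qed

text \<open>Deleting the first letter folds the hexagon of first-level cells onto a single copy of the
  carpet; it is a common left inverse of all six maps.\<close>

lift_definition hex_shift :: "hexacarpet \<Rightarrow> hexacarpet" is stl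
proof -
  fix s t show "hex_equiv s t \<Longrightarrow> hex_equiv (stl s) (stl t)"
    by (auto simp: hex_equiv_iff elim: hex_edge.cases)
qed

lemma hex_shift_map [simp]: "hex_shift (hex_map i x) = x"
  by (rule hexacarpet_cases[of x]) (simp add: hex_map.abs_eq hex_shift.abs_eq)

lemma hex_shift_in_cell: "w \<noteq> [] \<Longrightarrow> x \<in> hex_cell w \<Longrightarrow> hex_shift x \<in> hex_cell (tl w)"
  by (cases w) (auto simp: hex_cell_Cons)

text \<open>The two words of a pair have different first letters only if their common prefix is empty.\<close>

lemma first_cells_inter:
  assumes "\<pi> (i ## p) = \<pi> (j ## q)" "i \<noteq> j"
  obtains k v where "k \<notin> {0, 5}" "sset v \<subseteq> {0, 5}" "p = k ## v" "q = k ## v" "j = nbr k i"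
proof -
  have "hex_edge (i ## p) (j ## q)"
    using assms by (auto simp: hexacarpet_eq_iff)
  then show ?thesis
    using assms(2) by cases (auto intro: that)
qed

section \<open>The tent coordinate\<close>

text \<open>The Gray code digit: each letter outside \<open>{0, 5}\<close> reverses the orientation.\<close>

definition tent_bit :: "letter stream \<Rightarrow> nat \<Rightarrow> bool" where
  "tent_bit s n \<longleftrightarrow> odd (length (filter (\<lambda>i. i \<notin> {0, 5}) (stake (Suc n) s)))"

text \<open>The point of \<open>[0, 1]\<close> whose itinerary under the tent map is the word, with \<open>{0, 5}\<close> coding the
  branch with positive slope. The series gives the bounds \<open>0\<close> and \<open>1\<close> at once; afterwards only the
  functional equation \<open>tent_SCons\<close> matters.\<close>

definition tent :: "letter stream \<Rightarrow> real" where
  "tent s = (\<Sum>n. of_bool (tent_bit s n) * (1 / 2) ^ Suc n)"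

lemma tent_summable: "summable (\<lambda>n. of_bool (tent_bit s n) * (1 / 2 :: real) ^ Suc n)"
  by (rule summable_comparison_test[OF _ sums_summable[OF power_half_series]]) auto

lemma tent_bounds: "0 \<le> tent s" "tent s \<le> 1"
proof -
  show "0 \<le> tent s"
    unfolding tent_def by (rule suminf_nonneg[OF tent_summable]) auto
  have "tent s \<le> (\<Sum>n. (1 / 2) ^ Suc n)"
    unfolding tent_def
    by (rule suminf_le[OF _ tent_summable sums_summable[OF power_half_series]]) auto
  then show "tent s \<le> 1"
    using sums_unique[OF power_half_series] by simp
qed

lemma tent_SCons: "tent (i ## s) = (if i \<in> {0, 5} then tent s / 2 else 1 - tent s / 2)"
proof -
  have bit: "tent_bit (i ## s) 0 \<longleftrightarrow> i \<notin> {0, 5}"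
    "tent_bit (i ## s) (Suc n) \<longleftrightarrow> (i \<in> {0, 5}) = tent_bit s n" for n
    by (simp_all add: tent_bit_def)
  have split: "tent (i ## s) = of_bool (i \<notin> {0, 5}) / 2
      + (\<Sum>n. of_bool ((i \<in> {0, 5}) = tent_bit s n) * (1 / 2) ^ Suc (Suc n))"
    using suminf_split_head[OF tent_summable[of "i ## s"]]
    by (simp add: tent_def bit)
  show ?thesis
  proof (cases "i \<in> {0, 5}")
    case True
    have "(\<Sum>n. of_bool (tent_bit s n) * (1 / 2) ^ Suc (Suc n)) = tent s / 2"
      using suminf_mult[OF tent_summable[of s], of "1 / 2"]
      by (simp add: tent_def mult_ac)
    with True split show ?thesis by simp
  next
    case False
    have "(\<lambda>n. 1 / 2 * ((1 / 2) ^ Suc n - of_bool (tent_bit s n) * (1 / 2) ^ Suc n))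
        sums (1 / 2 * (1 - tent s))"
      unfolding tent_def
      by (intro sums_mult sums_diff power_half_series summable_sums tent_summable)
    also have "(\<lambda>n. 1 / 2 * ((1 / 2) ^ Suc n - of_bool (tent_bit s n) * (1 / 2 :: real) ^ Suc n))
        = (\<lambda>n. of_bool (\<not> tent_bit s n) * (1 / 2) ^ Suc (Suc n))"
      by (auto simp: fun_eq_iff)
    finally have "(\<Sum>n. of_bool (\<not> tent_bit s n) * (1 / 2) ^ Suc (Suc n)) = 1 / 2 * (1 - tent s)"
      by (rule sums_unique[symmetric])
    with False split show ?thesis by (simp add: field_simps)
  qed
qed

lemma tent_outer: "sset v \<subseteq> {0, 5} \<Longrightarrow> tent v = 0"
proof -
  assume "sset v \<subseteq> {0, 5}"
  then have "set (stake n v) \<subseteq> {0, 5}" for n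
    by (metis Un_subset_iff sset_shift stake_sdrop)
  then have "filter (\<lambda>i. i \<notin> {0, 5}) (stake n v) = []" for n
    by (auto simp: filter_empty_conv)
  then have "\<not> tent_bit v n" for n
    by (simp add: tent_bit_def del: stake.simps)
  then show ?thesis by (simp add: tent_def)
qed

lemma tent_shift_diff: "\<bar>tent (w @- s) - tent (w @- t)\<bar> = (1 / 2) ^ length w * \<bar>tent s - tent t\<bar>"
proof (induction w)
  case (Cons i w)
  have "\<bar>tent (i ## u) - tent (i ## v)\<bar> = 1 / 2 * \<bar>tent u - tent v\<bar>" for u v
    by (simp add: tent_SCons abs_if)
  with Cons show ?case by simp
qed simp

text \<open>Both branches of the tent map have the value 1 at the same point: in \<open>i k v\<close> with an outer
  tail, \<open>v\<close> has coordinate 0 and \<open>k v\<close> has coordinate 1, so \<open>i k v\<close> has coordinate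
  \<open>1 / 2\<close> for every \<open>i\<close>.\<close>

lemma tent_edge: "hex_edge s t \<Longrightarrow> tent s = tent t"
  by (induction rule: hex_edge.induct) (simp_all add: tent_SCons tent_outer)

lift_definition hex_tent :: "hexacarpet \<Rightarrow> real" is tent
  by (auto simp: hex_equiv_iff tent_edge)

lemma hex_tent_bounds: "0 \<le> hex_tent x" "hex_tent x \<le> 1"
  by (rule hexacarpet_cases[of x]; simp add: hex_tent.abs_eq tent_bounds)+

section \<open>Functions whose oscillation is controlled on cells\<close>

definition osc_bounded :: "real \<Rightarrow> real \<Rightarrow> (hexacarpet \<Rightarrow> real) \<Rightarrow> bool" where
  "osc_bounded \<mu> C H \<longleftrightarrow> (\<forall>w. \<forall>x \<in> hex_cell w. \<forall>y \<in> hex_cell w. \<bar>H x - H y\<bar> \<le> C * \<mu> ^ length w)"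

text \<open>Each letter halves the oscillation of \<open>tent\<close>, but multiplies the weight only by \<open>\<mu>\<close>. This is what
  distinguishes the metrics from the degenerate pseudo-metrics.\<close>

lemma osc_bounded_tent:
  assumes "\<mu> \<ge> 1 / 2"
  shows "osc_bounded \<mu> 1 hex_tent"
proof -
  have "\<bar>hex_tent (\<pi> (w @- s)) - hex_tent (\<pi> (w @- t))\<bar> \<le> \<mu> ^ length w" for w s t
  proof -
    have "\<bar>tent s - tent t\<bar> \<le> 1"
      using tent_bounds[of s] tent_bounds[of t] by linarith
    moreover have "(1 / 2) ^ length w \<le> \<mu> ^ length w"
      using assms by (intro power_mono) auto
    ultimately have "(1 / 2) ^ length w * \<bar>tent s - tent t\<bar> \<le> \<mu> ^ length w * 1"
      using assms by (intro mult_mono) auto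
    then show ?thesis by (simp add: hex_tent.abs_eq tent_shift_diff)
  qed
  then show ?thesis by (auto simp: osc_bounded_def hex_cell_eq)
qed

text \<open>Passing to the first-level cells loses one factor \<open>\<mu> \<ge> 1 / 2\<close>, whence the doubled constant; the
  whole carpet, which lies in no first-level cell, is dealt with by the bounds on \<open>H\<close>.\<close>

lemma osc_bounded_glue:
  assumes mu: "1 / 2 \<le> \<mu>" and C: "1 / 2 \<le> C"
    and H: "\<And>i. osc_bounded \<mu> C (\<lambda>x. H (hex_map i x))" "\<And>x. 0 \<le> H x" "\<And>x. H x \<le> 1"
  shows "osc_bounded \<mu> (2 * C) H"
  unfolding osc_bounded_def
proof (intro allI ballI)
  fix w x y assume xy: "x \<in> hex_cell w" "y \<in> hex_cell w"
  show "\<bar>H x - H y\<bar> \<le> 2 * C * \<mu> ^ length w"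
  proof (cases w)
    case Nil
    then show ?thesis using H(2,3)[of x] H(2,3)[of y] C by simp
  next
    case (Cons i w')
    then obtain x' y' where *: "x = hex_map i x'" "y = hex_map i y'" "x' \<in> hex_cell w'" "y' \<in> hex_cell w'"
      using xy by (auto simp: hex_cell_Cons)
    have "\<bar>H x - H y\<bar> \<le> C * \<mu> ^ length w'"
      using H(1)[of i] * unfolding osc_bounded_def by blast
    \<comment> \<open>The factor \<open>2 * \<mu> \<ge> 1\<close> accounts for the first letter of \<open>w\<close>.\<close>
    also have "\<dots> \<le> C * (2 * \<mu> * \<mu> ^ length w')"
      using mu C by (intro mult_left_mono mult_right_mono[of 1 "2 * \<mu>", simplified]) auto
    finally show ?thesis by (simp add: Cons)
  qed
qed

text \<open>A bump on the cell \<open>l\<close>: 1 on its outer side and 0 on the two sides along which it is glued to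
  other cells, so it extends by 0.\<close>

lift_definition bump :: "letter \<Rightarrow> hexacarpet \<Rightarrow> real" is
  "\<lambda>l s. if shd s = l then 1 - tent (stl s) else 0"
proof -
  fix l s t assume "hex_equiv s t"
  then consider "s = t" | "hex_edge s t" by (auto simp: hex_equiv_iff)
  then show "(if shd s = l then 1 - tent (stl s) else 0) = (if shd t = l then 1 - tent (stl t) else 0)"
  proof cases
    case 2
    then show ?thesis
      by cases (simp_all add: tent_SCons tent_outer tent_edge)
  qed simp
qed

text \<open>The bump on the subcell \<open>k\<close> of each of the two cells \<open>i\<close> and \<open>nbr k i\<close>. For \<open>k \<notin> {0, 5}\<close> the outer
  sides of these two subcells are glued to each other and the function is 1 there; on their other
  sides it is 0.\<close>

lift_definition edge_bump :: "letter \<Rightarrow> letter \<Rightarrow> hexacarpet \<Rightarrow> real" is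
  "\<lambda>i k s. if shd s \<in> {i, nbr k i} \<and> shd (stl s) = k then 1 - tent (stl (stl s)) else 0"
proof -
  fix i k s t assume "hex_equiv s t"
  then consider "s = t" | "hex_edge s t" by (auto simp: hex_equiv_iff)
  then show "(if shd s \<in> {i, nbr k i} \<and> shd (stl s) = k then 1 - tent (stl (stl s)) else 0) =
    (if shd t \<in> {i, nbr k i} \<and> shd (stl t) = k then 1 - tent (stl (stl t)) else 0)"
  proof cases
    case 2
    then show ?thesis
    proof cases
      case (base k' v i')
      have "nbr k i' \<in> {i, nbr k i} \<longleftrightarrow> i' \<in> {i, nbr k i}"
        by (metis insert_iff nbr_nbr singletonD)
      with base show ?thesis by auto
    next
      case (step s' t' l)
      from step(3) show ?thesis unfolding step(1,2)
        by cases (simp_all add: tent_SCons tent_outer tent_edge)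
    qed
  qed simp
qed

lemma bump_map: "bump l (hex_map i x) = (if i = l then 1 - hex_tent x else 0)"
  by (rule hexacarpet_cases[of x]) (simp add: hex_map.abs_eq bump.abs_eq hex_tent.abs_eq)

lemma edge_bump_map: "edge_bump i k (hex_map j x) = (if j \<in> {i, nbr k i} then bump k x else 0)"
  by (rule hexacarpet_cases[of x]) (simp add: hex_map.abs_eq bump.abs_eq edge_bump.abs_eq)

lemma hex_map_ex: obtains i y where "x = hex_map i y"
  by (rule hexacarpet_cases[of x]) (metis hex_map.abs_eq stream.collapse)

lemma bump_bounds: "0 \<le> bump l x" "bump l x \<le> 1"
  by (rule hex_map_ex[of x]; simp add: bump_map hex_tent_bounds)+

lemma edge_bump_bounds: "0 \<le> edge_bump i k x" "edge_bump i k x \<le> 1"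
  by (rule hex_map_ex[of x]; simp add: edge_bump_map bump_bounds)+

lemma osc_bounded_bump: "1 / 2 \<le> \<mu> \<Longrightarrow> osc_bounded \<mu> 2 (bump l)"
  using osc_bounded_glue[of \<mu> 1 "bump l"] osc_bounded_tent[of \<mu>]
  by (auto simp: bump_bounds bump_map osc_bounded_def abs_minus_commute)

lemma osc_bounded_edge_bump: "1 / 2 \<le> \<mu> \<Longrightarrow> osc_bounded \<mu> 4 (edge_bump i k)"
  using osc_bounded_glue[of \<mu> 2 "edge_bump i k"] osc_bounded_bump[of \<mu>]
  by (auto simp: edge_bump_bounds edge_bump_map osc_bounded_def)

section \<open>Self-similarity of the pseudo-metrics\<close>

locale hexacarpet_weight =
  fixes \<mu> :: real
  assumes mu_pos: "0 < \<mu>" and mu_less: "\<mu> < 1"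
begin

abbreviation d :: "hexacarpet \<Rightarrow> hexacarpet \<Rightarrow> real" where "d \<equiv> hex_dist \<mu>"

abbreviation weight :: "letter list list \<Rightarrow> real" where
  "weight ws \<equiv> \<Sum>w\<leftarrow>ws. hex_weight \<mu> w"

lemma hex_weight_pos: "0 < hex_weight \<mu> w"
  using mu_pos by (simp add: hex_weight_def)

lemma weight_nonneg: "0 \<le> weight ws"
  by (intro sum_list_nonneg) (auto intro: less_imp_le hex_weight_pos)

lemma hex_dist_le: "ws \<in> hex_chains x y \<Longrightarrow> d x y \<le> weight ws"
  unfolding hex_dist_def by (rule cINF_lower) (auto intro!: bdd_belowI[of _ 0] weight_nonneg)

lemma hex_chains_cell: "x \<in> hex_cell w \<Longrightarrow> y \<in> hex_cell w \<Longrightarrow> [w] \<in> hex_chains x y"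
  by (simp add: hex_chains_def)

lemma hex_chains_nonempty: "hex_chains x y \<noteq> {}"
  using hex_chains_cell[of x "[]" y] by auto

lemma hex_dist_greatest: "(\<And>ws. ws \<in> hex_chains x y \<Longrightarrow> c \<le> weight ws) \<Longrightarrow> c \<le> d x y"
  unfolding hex_dist_def by (rule cINF_greatest[OF hex_chains_nonempty])

lemma hex_dist_lessE:
  assumes "d x y < r" obtains ws where "ws \<in> hex_chains x y" "weight ws < r"
  using hex_dist_greatest[of x y r] assms by (meson linorder_not_le)

lemma hex_dist_nonneg: "0 \<le> d x y"
  by (rule hex_dist_greatest) (rule weight_nonneg)

lemma hex_dist_cell: "x \<in> hex_cell w \<Longrightarrow> y \<in> hex_cell w \<Longrightarrow> d x y \<le> \<mu> ^ length w"
  using hex_dist_le[OF hex_chains_cell] by (simp add: hex_weight_def)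

lemma hex_dist_le_1: "d x y \<le> 1"
  using hex_dist_cell[of x "[]" y] by simp

lemma hex_dist_refl [simp]: "d x x = 0"
proof -
  have "d x x \<le> \<mu> ^ n" for n
    using in_cell_ex[of n x] hex_dist_cell by blast
  moreover have "(\<lambda>n. \<mu> ^ n) \<longlonglongrightarrow> 0"
    using mu_pos mu_less by (intro LIMSEQ_realpow_zero) auto
  ultimately have "d x x \<le> 0"
    by (intro LIMSEQ_le_const) auto
  then show ?thesis using hex_dist_nonneg[of x x] by simp
qed

lemma hex_dist_sym: "d x y = d y x"
proof -
  have "d x y \<le> d y x" for x y
  proof (rule hex_dist_greatest)
    fix ws assume ws: "ws \<in> hex_chains y x"
    have "rev ws \<in> hex_chains x y"
      using ws by (auto simp: hex_chains_def hd_rev last_rev Int_commute)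
    then show "d x y \<le> weight ws"
      using hex_dist_le by (fastforce simp: rev_map[symmetric])
  qed
  then show ?thesis by (simp add: order_antisym)
qed

lemma hex_chains_append:
  "ws \<in> hex_chains x y \<Longrightarrow> ws' \<in> hex_chains y z \<Longrightarrow> ws @ ws' \<in> hex_chains x z"
  by (auto simp: hex_chains_def successively_append_iff)

lemma hex_dist_triangle: "d x z \<le> d x y + d y z"
proof -
  have "d x z - d y z \<le> d x y"
  proof (rule hex_dist_greatest)
    fix ws assume ws: "ws \<in> hex_chains x y"
    have "d x z - weight ws \<le> d y z"
    proof (rule hex_dist_greatest)
      fix ws' assume "ws' \<in> hex_chains y z"
      then show "d x z - weight ws \<le> weight ws'"
        using hex_dist_le[OF hex_chains_append[OF ws]] by force
    qed
    then show "d x z - d y z \<le> weight ws" by simp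
  qed
  then show ?thesis by simp
qed

lemma weight_map_Cons: "weight (map ((#) i) ws) = \<mu> * weight ws"
  by (induction ws) (auto simp: hex_weight_def algebra_simps)

lemma weight_map_tl: "[] \<notin> set ws \<Longrightarrow> \<mu> * weight (map tl ws) = weight ws"
proof (induction ws)
  case (Cons w ws)
  then show ?case by (cases w) (auto simp: hex_weight_def algebra_simps)
qed simp

lemma weight_Nil_mem:
  assumes "[] \<in> set ws" shows "1 \<le> weight ws"
proof -
  have "hex_weight \<mu> [] \<le> weight ws"
    using assms hex_weight_pos by (intro member_le_sum_list) (auto intro: less_imp_le)
  then show ?thesis by (simp add: hex_weight_def)
qed

lemma hex_chains_map_Cons:
  assumes "ws \<in> hex_chains x y" shows "map ((#) i) ws \<in> hex_chains (hex_map i x) (hex_map i y)"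
  using assms unfolding hex_chains_def
  by (auto simp: hd_map last_map successively_map hex_cell_Cons elim!: successively_mono)

lemma hex_chains_map_tl:
  assumes "ws \<in> hex_chains x y" "[] \<notin> set ws"
  shows "map tl ws \<in> hex_chains (hex_shift x) (hex_shift y)"
proof -
  have "hd ws \<noteq> []" "last ws \<noteq> []"
    using assms hd_in_set[of ws] last_in_set[of ws]
    by (auto simp: hex_chains_def simp del: hd_in_set last_in_set)
  moreover have "successively (\<lambda>v w. hex_cell (tl v) \<inter> hex_cell (tl w) \<noteq> {}) ws"
    if "successively (\<lambda>v w. hex_cell v \<inter> hex_cell w \<noteq> {}) ws"
    using that
  proof (rule successively_mono)
    fix v w assume "v \<in> set ws" "w \<in> set ws" "hex_cell v \<inter> hex_cell w \<noteq> {}"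
    then show "hex_cell (tl v) \<inter> hex_cell (tl w) \<noteq> {}"
      using hex_shift_in_cell[of v] hex_shift_in_cell[of w] assms(2) by blast
  qed
  ultimately show ?thesis
    using assms(1) unfolding hex_chains_def
    by (auto simp: hd_map last_map successively_map intro!: hex_shift_in_cell)
qed

text \<open>Deleting first letters divides the weight of a chain by \<open>\<mu>\<close>. A chain that contains the empty
  word cannot be shifted, but it has weight at least 1 and no distance exceeds 1.\<close>

lemma hex_dist_shift: "\<mu> * d (hex_shift x) (hex_shift y) \<le> d x y"
proof (rule hex_dist_greatest)
  fix ws assume ws: "ws \<in> hex_chains x y"
  show "\<mu> * d (hex_shift x) (hex_shift y) \<le> weight ws"
  proof (cases "[] \<in> set ws")
    case True
    have "\<mu> * d (hex_shift x) (hex_shift y) \<le> 1 * 1"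
      using mu_pos mu_less hex_dist_nonneg hex_dist_le_1 by (intro mult_mono) auto
    also have "\<dots> \<le> weight ws" using weight_Nil_mem[OF True] by simp
    finally show ?thesis .
  next
    case False
    have "\<mu> * d (hex_shift x) (hex_shift y) \<le> \<mu> * weight (map tl ws)"
      using mu_pos hex_dist_le[OF hex_chains_map_tl[OF ws False]] by (simp add: mult_left_mono)
    then show ?thesis using weight_map_tl[OF False] by simp
  qed
qed

text \<open>A chain between \<open>f\<^sub>i x\<close> and \<open>f\<^sub>i y\<close> may leave the cell \<open>i\<close>, but the shift folds it onto a chain
  between \<open>x\<close> and \<open>y\<close>.\<close>

lemma hex_dist_map: "d (hex_map i x) (hex_map i y) = \<mu> * d x y"
proof (rule order_antisym)
  show "\<mu> * d x y \<le> d (hex_map i x) (hex_map i y)"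
    using hex_dist_shift[of "hex_map i x" "hex_map i y"] by simp
  have "d (hex_map i x) (hex_map i y) / \<mu> \<le> d x y"
  proof (rule hex_dist_greatest)
    fix ws assume "ws \<in> hex_chains x y"
    then show "d (hex_map i x) (hex_map i y) / \<mu> \<le> weight ws"
      using hex_dist_le[OF hex_chains_map_Cons] weight_map_Cons mu_pos
      by (fastforce simp: field_simps)
  qed
  then show "d (hex_map i x) (hex_map i y) \<le> \<mu> * d x y"
    using mu_pos by (simp add: field_simps)
qed

lemma hex_dist_map_word: "d (hex_map_word w x) (hex_map_word w y) = \<mu> ^ length w * d x y"
  by (induction w) (simp_all add: hex_map_word_def hex_dist_map)

lemma hex_dist_SCons:
  "d (\<pi> (i ## s)) (\<pi> (i ## t)) = \<mu> * d (\<pi> s) (\<pi> t)"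
  using hex_dist_map[of i "\<pi> s" "\<pi> t"] by (simp add: hex_map.abs_eq)

text \<open>Let \<open>a\<close> and \<open>b\<close> be the points of \<open>000\<dots>\<close> and \<open>1000\<dots>\<close>. The cells \<open>0\<close> and \<open>1\<close> contain scaled copies
  of the pair \<open>a, b\<close> that share the image of \<open>b\<close> and have \<open>a\<close> and \<open>b\<close> as their other members. So
  \<open>d a b\<close> is at most \<open>2 * \<mu>\<close> times itself. The tent coordinate shows that \<open>a \<noteq> b\<close>.\<close>

lemma not_metric_below_half:
  assumes "\<mu> < 1 / 2"
  shows "\<not> Metric_space UNIV d"
proof
  assume "Metric_space UNIV d"
  then interpret M: Metric_space UNIV d .
  let ?z = "sconst 0 :: letter stream"
  let ?a = "\<pi> ?z" and ?b = "\<pi> (1 ## ?z)"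
  have z: "?z = 0 ## ?z" by (rule siterate.ctr[of id, simplified])
  have b0: "hex_map 0 ?b = hex_map 1 ?b"
    using edge_point_eq[of 1 ?z 0] by (simp add: hex_map.abs_eq nbr_def)
  have a0: "hex_map 0 ?a = ?a" "hex_map 1 ?a = ?b"
    using z by (simp_all add: hex_map.abs_eq)
  have "d ?a ?b \<le> d (hex_map 0 ?a) (hex_map 0 ?b) + d (hex_map 1 ?b) (hex_map 1 ?a)"
    using hex_dist_triangle[of ?a ?b "hex_map 0 ?b"] by (simp only: a0 b0)
  also have "\<dots> = 2 * \<mu> * d ?a ?b"
    by (simp add: hex_dist_map hex_dist_sym[of ?b])
  finally have "(1 - 2 * \<mu>) * d ?a ?b \<le> 0" by (simp add: algebra_simps)
  then have "d ?a ?b = 0"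
    using assms hex_dist_nonneg[of ?a ?b] by (simp add: mult_le_0_iff)
  then have "?a = ?b" by simp
  then have "hex_tent ?a = hex_tent ?b" by simp
  then show False by (simp add: hex_tent.abs_eq tent_SCons tent_outer)
qed

text \<open>The variation of \<open>H\<close> along a chain is at most the sum of its oscillations on the cells.\<close>

lemma osc_bounded_lipschitz:
  assumes H: "osc_bounded \<mu> C H" and C: "0 < C"
  shows "\<bar>H x - H y\<bar> \<le> C * d x y"
proof -
  have *: "\<bar>H x - H y\<bar> \<le> C * weight ws" if "ws \<in> hex_chains x y" for ws
    using that
  proof (induction ws arbitrary: x)
    case (Cons w ws)
    show ?case
    proof (cases ws)
      case Nil
      then show ?thesis using Cons.prems H
        by (auto simp: hex_chains_def osc_bounded_def hex_weight_def)
    next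
      case (Cons w' ws')
      then obtain z where z: "z \<in> hex_cell w" "z \<in> hex_cell w'"
        using Cons.prems by (auto simp: hex_chains_def)
      have "\<bar>H z - H y\<bar> \<le> C * weight ws"
        using Cons.prems Cons.IH[of z] z Cons by (simp add: hex_chains_def)
      moreover have "\<bar>H x - H z\<bar> \<le> C * hex_weight \<mu> w"
        using Cons.prems z H by (auto simp: hex_chains_def osc_bounded_def hex_weight_def)
      ultimately show ?thesis by (simp add: algebra_simps)
    qed
  qed (simp add: hex_chains_def)
  have "\<bar>H x - H y\<bar> / C \<le> d x y"
    using * C by (intro hex_dist_greatest) (auto simp: field_simps)
  then show ?thesis using C by (simp add: field_simps)
qed

text \<open>The point \<open>z\<close> is taken where the chain first uses a word that does not start with \<open>i\<close>; if there
  is no such word, then \<open>y\<close> itself lies in the cell \<open>i\<close>.\<close>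

lemma crossing_chain:
  assumes "ws \<in> hex_chains x y" "[] \<notin> set ws" "x \<in> hex_cell [i]" "y \<in> hex_cell [j]" "i \<noteq> j"
  shows "\<exists>z l. l \<noteq> i \<and> z \<in> hex_cell [i] \<inter> hex_cell [l] \<and> d x z \<le> weight ws \<and> d z y \<le> weight ws"
  using assms
proof (induction ws arbitrary: x)
  case (Cons w ws)
  have le: "d x y \<le> weight (w # ws)" by (rule hex_dist_le) fact
  obtain l u where w: "w = l # u" using Cons.prems by (cases w) auto
  have sub: "hex_cell w \<subseteq> hex_cell [l]" unfolding w by (auto simp: hex_cell_Cons)
  have xw: "x \<in> hex_cell w" using Cons.prems by (simp add: hex_chains_def)
  consider "l \<noteq> i" | "l = i" "ws = []" | w' ws' where "l = i" "ws = w' # ws'"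
    by (cases ws) auto
  then show ?case
  proof cases
    case 1
    then show ?thesis
      using Cons.prems le sub xw weight_nonneg[of "w # ws"] by (intro exI[of _ x] exI[of _ l]) auto
  next
    case 2
    then have "y \<in> hex_cell [i]" using Cons.prems sub by (auto simp: hex_chains_def)
    then show ?thesis
      using Cons.prems le weight_nonneg[of "w # ws"] by (intro exI[of _ y] exI[of _ j]) auto
  next
    case 3
    then obtain p where p: "p \<in> hex_cell w" "p \<in> hex_cell w'"
      using Cons.prems by (auto simp: hex_chains_def)
    have "ws \<in> hex_chains p y" using Cons.prems p 3 by (simp add: hex_chains_def)
    moreover have "p \<in> hex_cell [i]" using p sub 3 by auto
    ultimately obtain z l' where z: "l' \<noteq> i" "z \<in> hex_cell [i] \<inter> hex_cell [l']"
        "d p z \<le> weight ws" "d z y \<le> weight ws"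
      using Cons.IH[of p] Cons.prems by auto
    have "d x z \<le> hex_weight \<mu> w + weight ws"
      using hex_dist_triangle[of x z p] z(3) hex_dist_cell[OF xw p(1)] by (simp add: hex_weight_def)
    moreover have "d z y \<le> hex_weight \<mu> w + weight ws"
      using z(4) hex_weight_pos[of w] by simp
    ultimately show ?thesis using z(1,2) by auto
  qed
qed (simp add: hex_chains_def)

text \<open>Since \<open>r \<le> 1\<close>, a chain of weight less than \<open>r\<close> avoids the empty word, so each of its cells lies
  in a first-level cell.\<close>

lemma crossing:
  assumes "d (\<pi> (i ## s)) (\<pi> (j ## t)) < r" "r \<le> 1" "i \<noteq> j"
  obtains k v where "k \<notin> {0, 5}" "sset v \<subseteq> {0, 5}"
    "d (\<pi> (i ## s)) (\<pi> (i ## k ## v)) < r"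
    "d (\<pi> (i ## k ## v)) (\<pi> (j ## t)) < r"
proof -
  obtain ws where ws: "ws \<in> hex_chains (\<pi> (i ## s)) (\<pi> (j ## t))" "weight ws < r"
    using assms(1) by (rule hex_dist_lessE)
  have "[] \<notin> set ws" using weight_Nil_mem[of ws] ws(2) assms(2) by auto
  then obtain z l where z: "l \<noteq> i" "z \<in> hex_cell [i]" "z \<in> hex_cell [l]"
    "d (\<pi> (i ## s)) z < r" "d z (\<pi> (j ## t)) < r"
    using crossing_chain[OF ws(1), of i j] ws(2) assms(3) by (fastforce simp: hex_cell_eq)
  obtain p where p: "z = \<pi> (i ## p)"
    using z(2) by (auto simp: hex_cell_eq)
  obtain q where "z = \<pi> (l ## q)"
    using z(3) by (auto simp: hex_cell_eq)
  with p obtain k v where "k \<notin> {0, 5}" "sset v \<subseteq> {0, 5}" "p = k ## v"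
    using first_cells_inter[of i p l q] z(1) by metis
  then show ?thesis using that z(4,5) p by blast
qed

end

section \<open>Separation of points and diameters\<close>

lemma stream_eqI: "(\<And>n. s !! n = t !! n) \<Longrightarrow> s = t"
  using smap_alt[of id s t] by (simp add: stream.map_id)

locale hexacarpet_metric = hexacarpet_weight +
  assumes mu_half: "1 / 2 \<le> \<mu>"
begin

lemma mu_power_le_1: "\<mu> ^ n \<le> 1"
  using mu_pos mu_less by (simp add: power_le_one)

text \<open>At each level, the bump on the cell that contains \<open>u\<close> is 1 at \<open>u\<close> and 0 outside that cell, so a
  point with another first letter has distance at least \<open>1 / 2\<close> from \<open>u\<close>. The shift then passes to
  the next letter. The first letter of \<open>u\<close> is unrestricted because only the tail enters the value of
  the bump at \<open>u\<close>.\<close>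

lemma near_outer:
  assumes "sset (stl u) \<subseteq> {0, 5}" "d (\<pi> s) (\<pi> u) < \<mu> ^ n / 4"
  shows "stake n s = stake n u"
  using assms
proof (induction n arbitrary: s u)
  case (Suc n)
  obtain i s' l v where eq: "s = i ## s'" "u = l ## v" by (metis stream.collapse)
  have v: "sset v \<subseteq> {0, 5}" using Suc.prems eq by simp
  have "i = l"
  proof (rule ccontr)
    assume "i \<noteq> l"
    then have "\<bar>bump l (\<pi> s) - bump l (\<pi> u)\<bar> = 1"
      using v by (simp add: eq bump.abs_eq tent_outer)
    then show False
      using osc_bounded_lipschitz[OF osc_bounded_bump[OF mu_half], of l "\<pi> s" "\<pi> u"]
        Suc.prems(2) mu_power_le_1[of "Suc n"] by linarith
  qed
  have "sset (stl v) \<subseteq> {0, 5}" using v by (metis stl_sset subset_iff)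
  moreover have "d (\<pi> s') (\<pi> v) < \<mu> ^ n / 4"
    using Suc.prems(2) mu_pos by (simp add: eq \<open>i = l\<close> hex_dist_SCons)
  ultimately show ?case using Suc.IH[of v s'] by (simp add: eq \<open>i = l\<close>)
qed simp

text \<open>The bump across the common side confines the first letter to the two cells meeting there; its
  Lipschitz constant 4 is the reason for the factor \<open>1 / 4\<close>. Inside either cell, the shift moves the
  point to the outer side of the subcell \<open>k\<close>, where \<open>near_outer\<close> applies.\<close>

lemma near_edge:
  assumes k: "k \<notin> {0, 5}" and v: "sset v \<subseteq> {0, 5}"
    and near: "d (\<pi> s) (\<pi> (i ## k ## v)) < \<mu> ^ n / 4"
  shows "stake n s = stake n (i ## k ## v) \<or> stake n s = stake n (nbr k i ## k ## v)"
proof (cases n)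
  case (Suc m)
  obtain l s' where s: "s = l ## s'" by (metis stream.collapse)
  have *: "stake n s = stake n (l ## k ## v)"
    if "\<pi> (i ## k ## v) = \<pi> (l ## k ## v)"
  proof -
    have "d (\<pi> s') (\<pi> (k ## v)) < \<mu> ^ m / 4"
      using near mu_pos unfolding that s hex_dist_SCons Suc by simp
    then show ?thesis using near_outer[of "k ## v" s' m] v by (simp add: s Suc)
  qed
  have "l = i \<or> l = nbr k i"
  proof (rule ccontr)
    assume "\<not> ?thesis"
    then have "\<bar>edge_bump i k (\<pi> s) - edge_bump i k (\<pi> (i ## k ## v))\<bar> = 1"
      using v by (simp add: s edge_bump.abs_eq tent_outer)
    then show False
      using osc_bounded_lipschitz[OF osc_bounded_edge_bump[OF mu_half],
          of i k "\<pi> s" "\<pi> (i ## k ## v)"]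
        near mu_power_le_1[of n] by linarith
  qed
  then show ?thesis using * edge_point_eq[OF k v, of i] by auto
qed simp

text \<open>A small set with a common first letter is handled by the shift. Otherwise two of its points
  are joined by a short chain that crosses a side, so the whole set is close to one point of that
  side and the two representatives of this point determine all prefixes. The number two does
  not grow with \<open>n\<close>, since the induction stops as soon as first letters differ.\<close>

lemma two_cylinders:
  assumes "\<And>s t. s \<in> T \<Longrightarrow> t \<in> T \<Longrightarrow> d (\<pi> s) (\<pi> t) < \<mu> ^ n / 8"
  shows "\<exists>a b. length a = n \<and> length b = n \<and> stake n ` T \<subseteq> {a, b}"
  using assms
proof (induction n arbitrary: T)
  case (Suc n)
  show ?case
  proof (cases "\<exists>s \<in> T. \<exists>t \<in> T. shd s \<noteq> shd t")
    case True
    then obtain i s j t where st: "i ## s \<in> T" "j ## t \<in> T" "i \<noteq> j" by (metis stream.collapse)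
    have "\<mu> ^ Suc n / 8 \<le> 1" using mu_power_le_1[of "Suc n"] by linarith
    then obtain k v where kv: "k \<notin> {0, 5}" "sset v \<subseteq> {0, 5}"
        "d (\<pi> (i ## s)) (\<pi> (i ## k ## v)) < \<mu> ^ Suc n / 8"
      using crossing[OF Suc.prems[OF st(1,2)] _ st(3)] by metis
    \<comment> \<open>All of \<open>T\<close> is close to the crossing point; the triangle inequality turns \<open>1 / 8\<close> into \<open>1 / 4\<close>.\<close>
    have "stake (Suc n) u \<in> {stake (Suc n) (i ## k ## v), stake (Suc n) (nbr k i ## k ## v)}"
      if "u \<in> T" for u
    proof -
      have "d (\<pi> u) (\<pi> (i ## k ## v)) < \<mu> ^ Suc n / 4"
        using hex_dist_triangle[of "\<pi> u" "\<pi> (i ## k ## v)" "\<pi> (i ## s)"]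
          Suc.prems[OF that st(1)] kv(3) by linarith
      then show ?thesis using near_edge[OF kv(1,2)] by blast
    qed
    then have "stake (Suc n) ` T \<subseteq> {stake (Suc n) (i ## k ## v), stake (Suc n) (nbr k i ## k ## v)}"
      by blast
    then show ?thesis by (meson length_stake)
  next
    case False
    then obtain i where i: "\<And>s. s \<in> T \<Longrightarrow> s = i ## stl s" by (metis stream.collapse)
    have "d (\<pi> s) (\<pi> t) < \<mu> ^ n / 8" if "s \<in> stl ` T" "t \<in> stl ` T" for s t
    proof -
      have "i ## s \<in> T" "i ## t \<in> T" using that i by auto
      then show ?thesis using Suc.prems[of "i ## s" "i ## t"] mu_pos by (simp add: hex_dist_SCons)
    qed
    then obtain a b where ab: "length a = n" "length b = n" "stake n ` stl ` T \<subseteq> {a, b}"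
      using Suc.IH[of "stl ` T"] by blast
    have "stake (Suc n) ` T \<subseteq> {i # a, i # b}"
    proof
      fix w assume "w \<in> stake (Suc n) ` T"
      then obtain s where s: "s \<in> T" "w = stake (Suc n) s" by auto
      then have "w = i # stake n (stl s)" using i[of s] by (metis stake.simps(2) stream.sel(1))
      then show "w \<in> {i # a, i # b}" using ab(3) s(1) by auto
    qed
    then show ?thesis using ab(1,2) by (intro exI[of _ "i # a"] exI[of _ "i # b"]) auto
  qed
qed auto

text \<open>For every \<open>n\<close>, both words agree up to level \<open>n\<close> with the two representatives of some point of
  a common side. The side point depends on \<open>n\<close>, but its letters are read off from the words
  themselves.\<close>

lemma zero_dist_first_letters_differ:
  assumes zero: "d (\<pi> (i ## s)) (\<pi> (j ## t)) = 0" and ij: "i \<noteq> j"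
  shows "hex_edge (i ## s) (j ## t)"
proof -
  have approx: "\<exists>k v. k \<notin> {0, 5} \<and> sset v \<subseteq> {0, 5} \<and> j = nbr k i \<and>
      stake n s = stake n (k ## v) \<and> stake n t = stake n (k ## v)" for n
  proof -
    let ?r = "\<mu> ^ Suc n / 4"
    have r: "d (\<pi> (i ## s)) (\<pi> (j ## t)) < ?r" "?r \<le> 1"
      using zero mu_pos mu_power_le_1[of "Suc n"] by auto
    obtain k v where kv: "k \<notin> {0, 5}" "sset v \<subseteq> {0, 5}"
      "d (\<pi> (i ## s)) (\<pi> (i ## k ## v)) < ?r"
      "d (\<pi> (i ## k ## v)) (\<pi> (j ## t)) < ?r"
      using crossing[OF r ij] by metis
    have "stake (Suc n) (i ## s) = stake (Suc n) (i ## k ## v) \<or>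
        stake (Suc n) (i ## s) = stake (Suc n) (nbr k i ## k ## v)"
      using near_edge[OF kv(1-3)] .
    moreover have "stake (Suc n) (j ## t) = stake (Suc n) (i ## k ## v) \<or>
        stake (Suc n) (j ## t) = stake (Suc n) (nbr k i ## k ## v)"
      using kv(4) by (intro near_edge[OF kv(1,2)]) (simp only: hex_dist_sym)
    ultimately show ?thesis using kv(1,2) ij by (intro exI[of _ k] exI[of _ v]) auto
  qed
  \<comment> \<open>Comparing at level \<open>m + 1\<close> determines the letter with index \<open>m\<close>.\<close>
  have nth: "s !! m = t !! m \<and> (m > 0 \<longrightarrow> s !! m \<in> {0, 5})" for m
  proof -
    obtain k v where kv: "sset v \<subseteq> {0, 5}" "stake (Suc m) s = stake (Suc m) (k ## v)"
        "stake (Suc m) t = stake (Suc m) (k ## v)"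
      using approx[of "Suc m"] by blast
    have "s !! m = (k ## v) !! m" "t !! m = (k ## v) !! m"
      using kv by (metis lessI stake_nth)+
    moreover have "v !! (m - 1) \<in> {0, 5}"
      using kv(1) snth_sset by blast
    then have "(k ## v) !! m \<in> {0, 5}" if "m > 0"
      using that by (cases m) auto
    ultimately show ?thesis by simp
  qed
  obtain k v where kv: "k \<notin> {0, 5}" "j = nbr k i" "stake 1 s = stake 1 (k ## v)"
    using approx[of 1] by blast
  have s: "s = k ## stl s"
    using kv(3) by (metis One_nat_def list.inject stake.simps(2) stream.collapse stream.sel(1))
  have "stl s !! m \<in> {0, 5}" for m
    by (metis nth snth.simps(2) zero_less_Suc)
  then have "sset (stl s) \<subseteq> {0, 5}"
    by (auto simp: sset_range)
  moreover have "t = s"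
    using nth by (auto intro: stream_eqI)
  ultimately show ?thesis using hex_edge.base[OF kv(1), of "stl s" i] kv(2) s by metis
qed

text \<open>Shifting until the first disagreement of the two words preserves distance 0.\<close>

lemma zero_dist_imp_edge:
  "s !! m \<noteq> t !! m \<Longrightarrow> d (\<pi> s) (\<pi> t) = 0 \<Longrightarrow> hex_edge s t"
proof (induction m arbitrary: s t)
  case 0
  then show ?case
    using zero_dist_first_letters_differ[of "shd s" "stl s" "shd t" "stl t"] by simp
next
  case (Suc m)
  obtain i s' j t' where eq: "s = i ## s'" "t = j ## t'" by (metis stream.collapse)
  show ?case
  proof (cases "i = j")
    case True
    then have "d (\<pi> s') (\<pi> t') = 0"
      using Suc.prems(2) mu_pos by (simp add: eq hex_dist_SCons)
    then show ?thesis using Suc.IH[of s' t'] Suc.prems(1) True by (simp add: eq hex_edge.step)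
  next
    case False
    then show ?thesis using zero_dist_first_letters_differ Suc.prems(2) by (simp add: eq)
  qed
qed

lemma hex_dist_eq_0: "d x y = 0 \<longleftrightarrow> x = y"
proof
  assume "d x y = 0"
  obtain s t where st: "x = \<pi> s" "y = \<pi> t" by (metis hexacarpet_cases)
  have "s = t \<or> (\<exists>m. s !! m \<noteq> t !! m)"
    by (metis stream_eqI)
  then show "x = y"
    using zero_dist_imp_edge \<open>d x y = 0\<close> by (auto simp: st hexacarpet_eq_iff)
qed simp

lemma Metric_space_hex_dist: "Metric_space UNIV d"
  by unfold_locales
    (auto simp: hex_dist_nonneg hex_dist_eq_0 hex_dist_triangle intro: hex_dist_sym)

text \<open>The words \<open>000\<dots>\<close> and \<open>1000\<dots>\<close> have tent coordinates 0 and 1.\<close>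

lemma diam_attained: "\<exists>x y. d x y = 1"
proof -
  let ?x = "\<pi> (sconst 0)" and ?y = "\<pi> (1 ## sconst 0)"
  have "\<bar>hex_tent ?x - hex_tent ?y\<bar> \<le> 1 * d ?x ?y"
    by (rule osc_bounded_lipschitz[OF osc_bounded_tent[OF mu_half]]) simp
  then have "1 \<le> d ?x ?y" by (simp add: hex_tent.abs_eq tent_SCons tent_outer)
  then show ?thesis using hex_dist_le_1 order_antisym by blast
qed

lemma diam_cell: "Sup {d x y |x y. x \<in> hex_cell w \<and> y \<in> hex_cell w} = \<mu> ^ length w"
proof (rule cSup_eq_maximum)
  obtain x y where "d x y = 1" using diam_attained by blast
  then have "d (hex_map_word w x) (hex_map_word w y) = \<mu> ^ length w"
    by (simp add: hex_dist_map_word)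
  then have "\<exists>x y. \<mu> ^ length w = d x y \<and> x \<in> hex_cell w \<and> y \<in> hex_cell w"
    by (metis hex_cell_def rangeI)
  then show "\<mu> ^ length w \<in> {d x y |x y. x \<in> hex_cell w \<and> y \<in> hex_cell w}"
    by (rule CollectI)
qed (use hex_dist_cell in auto)

end

section \<open>Uniformly distributed words\<close>

definition uniform_words :: "letter stream measure" where
  "uniform_words = stream_space (measure_pmf (pmf_of_set UNIV))"

interpretation uniform_words: prob_space uniform_words
  unfolding uniform_words_def by (rule prob_space.prob_space_stream_space) (rule prob_space_measure_pmf)

lemma space_uniform_words [simp]: "space uniform_words = UNIV"
  by (simp add: uniform_words_def space_stream_space)

lemma sets_uniform_words: "sets uniform_words = sets (stream_space (count_space UNIV))"
  unfolding uniform_words_def by (rule sets_stream_space_cong) simp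

lemma sets_cylinder: "{s. stake n s \<in> A} \<in> sets uniform_words"
proof -
  have "stake n -` A \<inter> space (stream_space (count_space (UNIV :: letter set)))
      \<in> sets (stream_space (count_space UNIV))"
    by (rule measurable_sets[OF measurable_stake]) simp
  then show ?thesis by (simp add: sets_uniform_words space_stream_space vimage_def)
qed

text \<open>The first letter is uniform and independent of the shifted word.\<close>

lemma emeasure_cylinder: "emeasure uniform_words {s. stake (length w) s = w} = ennreal ((1 / 6) ^ length w)"
proof (induction w)
  case Nil
  then show ?case using uniform_words.emeasure_space_1 by simp
next
  case (Cons i w)
  have "emeasure uniform_words {s. stake (length (i # w)) s = i # w} =
      (\<integral>\<^sup>+l. emeasure uniform_words {s \<in> space uniform_words. l ## s \<in> {s. stake (length (i # w)) s = i # w}}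
        \<partial>measure_pmf (pmf_of_set UNIV))"
    unfolding uniform_words_def
    by (rule prob_space.emeasure_stream_space[OF prob_space_measure_pmf])
      (use sets_cylinder[of "length (i # w)" "{i # w}"] in \<open>simp add: uniform_words_def\<close>)
  also have "\<dots> = (\<integral>\<^sup>+l. ennreal ((1 / 6) ^ length w) * indicator {i} l \<partial>measure_pmf (pmf_of_set UNIV))"
    by (intro nn_integral_cong) (auto simp: Cons indicator_def)
  also have "\<dots> = ennreal ((1 / 6) ^ length w) * emeasure (measure_pmf (pmf_of_set UNIV)) {i}"
    by (rule nn_integral_cmult_indicator) simp
  also have "emeasure (measure_pmf (pmf_of_set (UNIV :: letter set))) {i} = ennreal (1 / 6)"
    by (simp add: emeasure_pmf_single)
  finally show ?case by (simp add: ennreal_mult[symmetric])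
qed

section \<open>Hausdorff measure and dimension\<close>

context hexacarpet_metric
begin

definition \<alpha> :: real where "\<alpha> = - ln 6 / ln \<mu>"

lemma alpha_pos: "0 < \<alpha>"
  using mu_pos mu_less by (simp add: \<alpha>_def divide_less_0_iff ln_less_zero)

lemma mu_powr_alpha: "\<mu> powr \<alpha> = 1 / 6"
  using mu_pos mu_less by (simp add: powr_def \<alpha>_def exp_minus field_simps)

lemma mu_power_powr: "(\<mu> ^ n) powr s = (\<mu> powr s) ^ n"
  using mu_pos by (simp add: powr_realpow[symmetric] powr_powr mult.commute)

lemma set_ediam_le_1: "set_ediam d A \<le> 1"
  unfolding set_ediam_def by (intro SUP_least) (simp add: hex_dist_le_1)

lemma set_ediam_real:
  "\<exists>D. 0 \<le> D \<and> D \<le> 1 \<and> set_ediam d A = ennreal D \<and> (\<forall>x \<in> A. \<forall>y \<in> A. d x y \<le> D)"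
proof -
  obtain D where D: "0 \<le> D" "set_ediam d A = ennreal D" "D \<le> 1"
    using set_ediam_le_1[of A] by (cases "set_ediam d A") (auto simp: top_unique)
  have "d x y \<le> D" if "x \<in> A" "y \<in> A" for x y
  proof -
    have "ennreal (d x y) \<le> set_ediam d A"
      unfolding set_ediam_def using that by (meson SUP_upper SUP_upper2)
    then show ?thesis using D by simp
  qed
  then show ?thesis using D by blast
qed

text \<open>The level \<open>n\<close> that fits a set of diameter \<open>D > 0\<close> is the last one with \<open>8 * D < \<mu>\<^sup>n\<close>, or 0 if
  there is none. The constant 12 is made up of the two cylinders and the factor 6 between
  consecutive levels. The error \<open>\<epsilon>\<close> serves the case \<open>D = 0\<close>, where every level fits.\<close>

lemma diam_scale:
  assumes "0 \<le> D" "0 < \<epsilon>"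
  shows "\<exists>n. (n = 0 \<or> D < \<mu> ^ n / 8) \<and> 2 * (1 / 6) ^ n \<le> 12 * (8 * D) powr \<alpha> + \<epsilon>"
proof (cases "D = 0")
  case True
  obtain n where "(1 / 6 :: real) ^ n < \<epsilon> / 2"
    using real_arch_pow_inv[of "\<epsilon> / 2" "1 / 6"] assms by auto
  then show ?thesis using True mu_pos by (intro exI[of _ n]) auto
next
  case False
  obtain n0 where n0: "\<mu> ^ n0 < 8 * D"
    using real_arch_pow_inv[of "8 * D" \<mu>] assms False mu_less by auto
  define m where "m = (LEAST m. \<mu> ^ m \<le> 8 * D)"
  have m: "\<mu> ^ m \<le> 8 * D" "\<And>n. n < m \<Longrightarrow> 8 * D < \<mu> ^ n"
    using LeastI[of "\<lambda>m. \<mu> ^ m \<le> 8 * D" n0] not_less_Least[of _ "\<lambda>m. \<mu> ^ m \<le> 8 * D"] n0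
    by (auto simp: m_def not_le)
  have "(1 / 6) ^ m \<le> (8 * D) powr \<alpha>"
    using powr_mono2[of \<alpha> "\<mu> ^ m" "8 * D"] m(1) alpha_pos mu_pos by (simp add: mu_power_powr mu_powr_alpha)
  moreover have "(1 / 6 :: real) ^ (m - 1) \<le> 6 * (1 / 6) ^ m"
    by (cases m) auto
  moreover have "m - 1 = 0 \<or> D < \<mu> ^ (m - 1) / 8"
    using m(2)[of "m - 1"] by (cases m) auto
  ultimately show ?thesis using assms(2) by (intro exI[of _ "m - 1"]) auto
qed

text \<open>The words representing a set \<open>A\<close> need not form a measurable set, so their mass is estimated
  through a measurable superset, the union of two cylinders.\<close>

lemma cylinder_cover:
  assumes "0 < \<epsilon>"
  shows "\<exists>V \<in> sets uniform_words. {s. \<pi> s \<in> A} \<subseteq> V \<and>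
    emeasure uniform_words V \<le> ennreal (12 * 8 powr \<alpha>) * ediam_powr d \<alpha> A + ennreal \<epsilon>"
proof (cases "A = {}")
  case True
  then show ?thesis by (intro bexI[of _ "{}"]) auto
next
  case False
  obtain D where D: "0 \<le> D" "set_ediam d A = ennreal D" "\<And>x y. x \<in> A \<Longrightarrow> y \<in> A \<Longrightarrow> d x y \<le> D"
    using set_ediam_real[of A] by blast
  obtain n where n: "n = 0 \<or> D < \<mu> ^ n / 8" "2 * (1 / 6) ^ n \<le> 12 * (8 * D) powr \<alpha> + \<epsilon>"
    using diam_scale[OF D(1) assms] by blast
  have "\<exists>a b. length a = n \<and> length b = n \<and> stake n ` {s. \<pi> s \<in> A} \<subseteq> {a, b}"
  proof (cases "n = 0")
    case False
    show ?thesis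
    proof (rule two_cylinders)
      fix s t assume "s \<in> {s. \<pi> s \<in> A}" "t \<in> {s. \<pi> s \<in> A}"
      then have "d (\<pi> s) (\<pi> t) \<le> D" by (simp add: D(3))
      then show "d (\<pi> s) (\<pi> t) < \<mu> ^ n / 8" using n(1) False by simp
    qed
  qed auto
  then obtain a b where ab: "length a = n" "length b = n" "stake n ` {s. \<pi> s \<in> A} \<subseteq> {a, b}"
    by blast
  let ?V = "{s. stake n s \<in> {a}} \<union> {s. stake n s \<in> {b}}"
  have "emeasure uniform_words ?V \<le>
      emeasure uniform_words {s. stake n s \<in> {a}} + emeasure uniform_words {s. stake n s \<in> {b}}"
    by (intro emeasure_subadditive sets_cylinder)
  also have "\<dots> = ennreal (2 * (1 / 6) ^ n)"
    using emeasure_cylinder[of a] emeasure_cylinder[of b] ab by (simp flip: ennreal_plus)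
  also have "\<dots> \<le> ennreal (12 * (8 * D) powr \<alpha> + \<epsilon>)"
    using n(2) by (rule ennreal_leI)
  also have "\<dots> = ennreal (12 * 8 powr \<alpha>) * ediam_powr d \<alpha> A + ennreal \<epsilon>"
    using assms D False alpha_pos by (simp add: ediam_powr_def powr_mult ennreal_mult mult.assoc)
  finally have "emeasure uniform_words ?V \<le>
      ennreal (12 * 8 powr \<alpha>) * ediam_powr d \<alpha> A + ennreal \<epsilon>" .
  moreover have "?V \<in> sets uniform_words"
    by (intro sets.Un sets_cylinder)
  moreover have "{s. \<pi> s \<in> A} \<subseteq> ?V"
    using ab(3) by auto
  ultimately show ?thesis by blast
qed

text \<open>The cylinder covers of the sets \<open>U n\<close> exhaust all words, which have total mass 1; the errors in
  the separate estimates are chosen with sum \<open>\<epsilon>\<close>.\<close>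

lemma mass_distribution:
  assumes cover: "UNIV \<subseteq> (\<Union>n. U n)"
  shows "1 \<le> ennreal (12 * 8 powr \<alpha>) * (\<Sum>n. ediam_powr d \<alpha> (U n))"
proof (rule ennreal_le_epsilon)
  fix \<epsilon> :: real assume eps: "0 < \<epsilon>"
  define V where "V n = (SOME V. V \<in> sets uniform_words \<and> {s. \<pi> s \<in> U n} \<subseteq> V \<and>
      emeasure uniform_words V \<le> ennreal (12 * 8 powr \<alpha>) * ediam_powr d \<alpha> (U n)
        + ennreal (\<epsilon> * (1 / 2) ^ Suc n))" for n
  have V: "V n \<in> sets uniform_words \<and> {s. \<pi> s \<in> U n} \<subseteq> V n \<and>
      emeasure uniform_words (V n) \<le> ennreal (12 * 8 powr \<alpha>) * ediam_powr d \<alpha> (U n)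
        + ennreal (\<epsilon> * (1 / 2) ^ Suc n)" for n
    unfolding V_def by (rule someI_ex) (use cylinder_cover[of "\<epsilon> * (1 / 2) ^ Suc n" "U n"] eps in auto)
  have "s \<in> (\<Union>n. V n)" for s
  proof -
    obtain n where "\<pi> s \<in> U n" using cover by auto
    then show ?thesis using V[of n] by auto
  qed
  then have UV: "(\<Union>n. V n) = UNIV" by blast
  have "1 = emeasure uniform_words (\<Union>n. V n)"
    unfolding UV using uniform_words.emeasure_space_1 by simp
  also have "\<dots> \<le> (\<Sum>n. emeasure uniform_words (V n))"
    using V by (intro emeasure_subadditive_countably) auto
  also have "\<dots> \<le> (\<Sum>n. ennreal (12 * 8 powr \<alpha>) * ediam_powr d \<alpha> (U n)
        + ennreal (\<epsilon> * (1 / 2) ^ Suc n))"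
    using V by (intro suminf_le) auto
  also have "\<dots> = ennreal (12 * 8 powr \<alpha>) * (\<Sum>n. ediam_powr d \<alpha> (U n)) + (\<Sum>n. ennreal (\<epsilon> * (1 / 2) ^ Suc n))"
    by (simp add: suminf_add[symmetric])
  also have "(\<Sum>n. ennreal (\<epsilon> * (1 / 2) ^ Suc n)) = ennreal \<epsilon>"
    using eps sums_mult[OF power_half_series, of \<epsilon>] by (intro suminf_ennreal_eq) auto
  finally show "1 \<le> ennreal (12 * 8 powr \<alpha>) * (\<Sum>n. ediam_powr d \<alpha> (U n)) + ennreal \<epsilon>" .
qed

text \<open>All diameters are at most 1. For \<open>s = 0\<close> this uses that a non-empty set has weight 1.\<close>

lemma ediam_powr_antimono:
  assumes "0 \<le> s" "s \<le> \<alpha>" shows "ediam_powr d \<alpha> A \<le> ediam_powr d s A"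
proof -
  obtain D where D: "0 \<le> D" "D \<le> 1" "set_ediam d A = ennreal D"
    using set_ediam_real[of A] by blast
  have "D powr \<alpha> \<le> 1" using D alpha_pos by (intro powr_le1) auto
  moreover have "D powr \<alpha> \<le> D powr s"
    using D assms by (cases "D = 0") (auto intro: powr_mono')
  ultimately show ?thesis
    using D alpha_pos by (auto simp: ediam_powr_def ennreal_leI)
qed

text \<open>The mass bound does not depend on the mesh \<open>\<delta>\<close> of the cover, so \<open>\<delta> = 1\<close> suffices.\<close>

lemma hausdorff_measure_pos:
  assumes "0 \<le> s" "s \<le> \<alpha>" shows "0 < hausdorff_measure d s UNIV"
proof -
  let ?C = "12 * 8 powr \<alpha>"
  have C: "0 < ?C" by simp
  have "ennreal (1 / ?C) \<le> hausdorff_premeasure d s 1 UNIV"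
    unfolding hausdorff_premeasure_def
  proof (rule INF_greatest)
    fix U :: "nat \<Rightarrow> hexacarpet set"
    assume "U \<in> {U. UNIV \<subseteq> (\<Union>n. U n) \<and> (\<forall>n. set_ediam d (U n) \<le> ennreal 1)}"
    then have "1 \<le> ennreal ?C * (\<Sum>n. ediam_powr d \<alpha> (U n))"
      by (intro mass_distribution) auto
    also have "\<dots> \<le> ennreal ?C * (\<Sum>n. ediam_powr d s (U n))"
      using assms by (intro mult_left_mono suminf_le ediam_powr_antimono) auto
    finally have "ennreal (1 / ?C) * 1 \<le> ennreal (1 / ?C) * (ennreal ?C * (\<Sum>n. ediam_powr d s (U n)))"
      by (rule mult_left_mono) simp
    also have "\<dots> = (\<Sum>n. ediam_powr d s (U n))"
      using C by (simp add: mult.assoc[symmetric] flip: ennreal_mult)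
    finally show "ennreal (1 / ?C) \<le> (\<Sum>n. ediam_powr d s (U n))" by simp
  qed
  also have "\<dots> \<le> hausdorff_measure d s UNIV"
    unfolding hausdorff_measure_def by (intro SUP_upper) simp
  finally have "ennreal (1 / ?C) \<le> hausdorff_measure d s UNIV" .
  moreover have "0 < ennreal (1 / ?C)" by simp
  ultimately show ?thesis by (rule less_le_trans[rotated])
qed

text \<open>The cover by all \<open>6\<^sup>n\<close> cells of level \<open>n\<close>, which have diameter at most \<open>\<mu>\<^sup>n\<close>.\<close>

lemma hausdorff_premeasure_le:
  assumes "0 < s" "\<mu> ^ n \<le> \<delta>"
  shows "hausdorff_premeasure d s \<delta> UNIV \<le> ennreal ((6 * \<mu> powr s) ^ n)"
proof -
  let ?W = "{w :: letter list. length w = n}"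
  have W: "finite ?W" "card ?W = 6 ^ n"
    using finite_lists_length_eq[of "UNIV :: letter set" n]
      card_lists_length_eq[of "UNIV :: letter set" n] by simp_all
  obtain f where f: "bij_betw f {0..<(6 ^ n :: nat)} ?W"
    using ex_bij_betw_nat_finite[OF W(1)] unfolding W(2) by blast
  define U where "U k = (if k < 6 ^ n then hex_cell (f k) else {})" for k :: nat
  have ediam: "set_ediam d (U k) \<le> ennreal (\<mu> ^ n)" for k
  proof (cases "k < 6 ^ n")
    case True
    then have "length (f k) = n" using f by (auto simp: bij_betw_def)
    then have "d x y \<le> \<mu> ^ n" if "x \<in> hex_cell (f k)" "y \<in> hex_cell (f k)" for x y
      using hex_dist_cell[OF that] by simp
    then show ?thesis
      using True unfolding set_ediam_def U_def by (simp add: SUP_le_iff ennreal_leI)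
  qed (simp add: U_def set_ediam_def)
  have "x \<in> (\<Union>k. U k)" for x
  proof -
    obtain w where w: "length w = n" "x \<in> hex_cell w" using in_cell_ex by blast
    then have "w \<in> f ` {0..<6 ^ n}" using f by (simp add: bij_betw_def)
    then obtain k where "k < 6 ^ n" "w = f k" by auto
    with w have "x \<in> U k" by (simp add: U_def)
    then show ?thesis by blast
  qed
  then have "UNIV \<subseteq> (\<Union>k. U k)" by blast
  moreover have "set_ediam d (U k) \<le> ennreal \<delta>" for k
    using ediam ennreal_leI[OF assms(2)] by (rule order_trans)
  ultimately have "hausdorff_premeasure d s \<delta> UNIV \<le> (\<Sum>k. ediam_powr d s (U k))"
    unfolding hausdorff_premeasure_def by (intro INF_lower) simp
  also have "\<dots> = (\<Sum>k<6 ^ n. ediam_powr d s (U k))"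
    by (rule suminf_finite) (auto simp: U_def ediam_powr_def)
  also have "\<dots> \<le> of_nat (card {..<6 ^ n :: nat}) * ennreal ((\<mu> ^ n) powr s)"
  proof (rule sum_bounded_above)
    fix k
    have "enn2real (set_ediam d (U k)) \<le> \<mu> ^ n"
      using enn2real_mono[OF ediam] mu_pos by simp
    then show "ediam_powr d s (U k) \<le> ennreal ((\<mu> ^ n) powr s)"
      using assms(1) by (auto simp: ediam_powr_def intro!: ennreal_leI powr_mono2)
  qed
  also have "\<dots> = ennreal (6 ^ n) * ennreal ((\<mu> ^ n) powr s)"
    by (simp add: ennreal_of_nat_eq_real_of_nat)
  also have "\<dots> = ennreal ((6 * \<mu> powr s) ^ n)"
    by (simp add: mu_power_powr power_mult_distrib flip: ennreal_mult)
  finally show ?thesis .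
qed

lemma eventually_mu_power_le: "0 < \<delta> \<Longrightarrow> eventually (\<lambda>n. \<mu> ^ n \<le> \<delta>) sequentially"
proof -
  assume "0 < \<delta>"
  moreover have "(\<lambda>n. \<mu> ^ n) \<longlonglongrightarrow> 0"
    using mu_pos mu_less by (intro LIMSEQ_realpow_zero) auto
  ultimately show ?thesis
    using order_tendstoD(2) by (fastforce elim: eventually_mono)
qed

text \<open>For \<open>s = \<alpha>\<close> the covers by cells of one level all contribute exactly \<open>6\<^sup>n * (1 / 6)\<^sup>n = 1\<close> to the
  upper bound.\<close>

lemma hausdorff_measure_alpha_le: "hausdorff_measure d \<alpha> UNIV \<le> 1"
  unfolding hausdorff_measure_def
proof (rule SUP_least)
  fix \<delta> :: real assume "\<delta> \<in> {0<..}"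
  then obtain n where "\<mu> ^ n \<le> \<delta>" using eventually_happens[OF eventually_mu_power_le] by auto
  from hausdorff_premeasure_le[OF alpha_pos this]
  show "hausdorff_premeasure d \<alpha> \<delta> UNIV \<le> 1" by (simp add: mu_powr_alpha)
qed

text \<open>The covers by cells of level \<open>n\<close> contribute \<open>(6 * \<mu>\<^sup>s)\<^sup>n\<close>, which tends to 0 because
  \<open>\<mu>\<^sup>s < \<mu>\<^sup>\<alpha> = 1 / 6\<close>.\<close>

lemma hausdorff_measure_eq_0:
  assumes "\<alpha> < s" shows "hausdorff_measure d s UNIV = 0"
proof -
  have "hausdorff_premeasure d s \<delta> UNIV \<le> 0" if "0 < \<delta>" for \<delta>
  proof (rule tendsto_lowerbound)
    have "\<mu> powr s < \<mu> powr \<alpha>" using mu_pos mu_less assms by (intro powr_less_mono') auto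
    then have "(\<lambda>n. (6 * \<mu> powr s) ^ n) \<longlonglongrightarrow> 0"
      by (intro LIMSEQ_realpow_zero) (auto simp: mu_powr_alpha)
    then have "(\<lambda>n. ennreal ((6 * \<mu> powr s) ^ n)) \<longlonglongrightarrow> ennreal 0"
      by (rule tendsto_ennrealI)
    then show "(\<lambda>n. ennreal ((6 * \<mu> powr s) ^ n)) \<longlonglongrightarrow> 0"
      by simp
    show "\<forall>\<^sub>F n in sequentially. hausdorff_premeasure d s \<delta> UNIV \<le> ennreal ((6 * \<mu> powr s) ^ n)"
      using eventually_mu_power_le[OF that]
      by eventually_elim (use hausdorff_premeasure_le assms alpha_pos in auto)
  qed simp
  then show ?thesis unfolding hausdorff_measure_def by (simp add: SUP_eq_iff)
qed

text \<open>The Hausdorff measure is positive for exponents up to \<open>\<alpha>\<close> and zero beyond.\<close>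

lemma hausdorff_dim_eq: "hausdorff_dim d UNIV = ennreal \<alpha>"
proof (rule order_antisym)
  show "ennreal \<alpha> \<le> hausdorff_dim d UNIV"
    unfolding hausdorff_dim_def
  proof (rule INF_greatest)
    fix s assume "s \<in> {s. 0 \<le> s \<and> hausdorff_measure d s UNIV = 0}"
    then show "ennreal \<alpha> \<le> ennreal s"
      using hausdorff_measure_pos[of s] by (intro ennreal_leI) force
  qed
  show "hausdorff_dim d UNIV \<le> ennreal \<alpha>"
  proof (rule ennreal_le_epsilon)
    fix e :: real assume "0 < e"
    then have "hausdorff_dim d UNIV \<le> ennreal (\<alpha> + e)"
      unfolding hausdorff_dim_def
      using alpha_pos by (intro INF_lower) (auto intro: hausdorff_measure_eq_0)
    then show "hausdorff_dim d UNIV \<le> ennreal \<alpha> + ennreal e"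
      using alpha_pos \<open>0 < e\<close> by simp
  qed
qed

end

theorem theorem2p1:
  fixes \<mu> :: real
  assumes "\<mu> \<in> {0<..<1}"
  shows "(Metric_space UNIV (hex_dist \<mu>) \<longleftrightarrow> \<mu> \<in> {1/2..<1}) \<and>
    (\<mu> \<in> {1/2..<1} \<longrightarrow>
      (\<forall>i x y. hex_dist \<mu> (hex_map i x) (hex_map i y) = \<mu> * hex_dist \<mu> x y) \<and>
      (\<forall>w. Sup {hex_dist \<mu> x y | x y. x \<in> hex_cell w \<and> y \<in> hex_cell w} = \<mu> ^ length w) \<and>
      hausdorff_dim (hex_dist \<mu>) UNIV = ennreal (- ln 6 / ln \<mu>) \<and>
      normalized_hausdorff_measure_exists (hex_dist \<mu>) (- ln 6 / ln \<mu>))"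
proof -
  interpret hexacarpet_weight \<mu>
    using assms by unfold_locales auto
  show ?thesis
  proof (cases "1 / 2 \<le> \<mu>")
    case True
    interpret hexacarpet_metric \<mu>
      using True by unfold_locales
    have "normalized_hausdorff_measure_exists d \<alpha>"
      using hausdorff_measure_pos[of \<alpha>] alpha_pos hausdorff_measure_alpha_le
      by (auto simp: normalized_hausdorff_measure_exists_def intro: le_less_trans)
    then show ?thesis
      using Metric_space_hex_dist hex_dist_map diam_cell hausdorff_dim_eq True assms
      unfolding \<alpha>_def by auto
  next
    case False
    then show ?thesis using not_metric_below_half by auto
  qed
qed

end
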